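(* Let $m,n$ be integers with $m\ge 2$ and $n\ge 3$, and let $G=C_m\oplus C_{mn}$. There exists a sequence $S$ over $G$ of length $\mathsf{s}(G)-1$ that has no zero-sum subsequence of length $\exp(G)$ and yet satisfies $v_g(S)<\exp(G)-1$ for each $g\in G$.
   Context: $C_k$ is a cyclic group of order $k$, groups are written additively, and $\exp(G)$ is the exponent of $G$. A sequence over $G$ is an element of the multiplicatively written free abelian monoid over $G$, i.e. a finite multiset $S=\prod_{g\in G}g^{v_g(S)}$, where $v_g(S)\in\mathbb{N}_0$ is the multiplicity of $g$ in $S$. The length is $|S|=\sum_g v_g(S)$ and the sum is $\sum_g v_g(S)g\in G$. A subsequence of $S$ is a sub-multiset (divisor in the monoid). A sequence is zero-sum if its sum is $0$. $\mathsf{s}(G)$ is the smallest positive integer $\ell$ such that each sequence over $G$ of length at least $\ell$ has a zero-sum subsequence of length exactly $\exp(G)$. *)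

theory Defs
  imports "HOL-Algebra.Algebra" "HOL-Library.Multiset"
begin

text \<open>
  Groups are those of HOL-Algebra, whose operation is written multiplicatively: the multiple
  \<open>k g\<close> of additive notation is \<open>g [^]\<^bsub>G\<^esub> k\<close>, the element \<open>0\<close> is \<open>\<one>\<^bsub>G\<^esub>\<close>, and the direct
  sum of two groups is \<open>\<times>\<times>\<close>.  A sequence over \<open>G\<close> is a finite multiset \<open>S\<close> with
  \<open>set_mset S \<subseteq> carrier G\<close>; then \<open>v\<^sub>g(S)\<close> is \<open>count S g\<close>, the length is \<open>size S\<close>, and
  subsequences are given by \<open>\<subseteq>#\<close>.
\<close>

text \<open>For finite abelian \<open>G\<close> the minima defining \<open>group_exponent\<close> and \<open>s_const\<close> are attained.\<close>

definition group_exponent :: "('a, 'b) monoid_scheme \<Rightarrow> nat" where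
  "group_exponent G = (LEAST k. 0 < k \<and> (\<forall>g\<in>carrier G. g [^]\<^bsub>G\<^esub> k = \<one>\<^bsub>G\<^esub>))"

definition seq_sum :: "('a, 'b) monoid_scheme \<Rightarrow> 'a multiset \<Rightarrow> 'a" where
  "seq_sum G S = (\<Otimes>\<^bsub>G\<^esub>g\<in>set_mset S. g [^]\<^bsub>G\<^esub> count S g)"

definition zero_sum :: "('a, 'b) monoid_scheme \<Rightarrow> 'a multiset \<Rightarrow> bool" where
  "zero_sum G S \<longleftrightarrow> seq_sum G S = \<one>\<^bsub>G\<^esub>"

definition has_zero_sum_subseq_of_length ::
  "('a, 'b) monoid_scheme \<Rightarrow> nat \<Rightarrow> 'a multiset \<Rightarrow> bool" where
  "has_zero_sum_subseq_of_length G k S \<longleftrightarrow> (\<exists>T. T \<subseteq># S \<and> size T = k \<and> zero_sum G T)"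

definition s_const :: "('a, 'b) monoid_scheme \<Rightarrow> nat" where
  "s_const G = (LEAST l. 0 < l \<and>
     (\<forall>S. set_mset S \<subseteq> carrier G \<and> l \<le> size S
        \<longrightarrow> has_zero_sum_subseq_of_length G (group_exponent G) S))"

end

theory Submission
  imports Defs "HOL-Number_Theory.Residues"
begin

text \<open>
  Write \<open>N = mn\<close> for the exponent of \<open>G\<close>.  The argument compares an arbitrary extremal sequence
  with an explicit one.

  By minimality of \<open>s(G)\<close> there is a sequence \<open>S\<close> of length \<open>s(G) - 1\<close> without a zero-sum
  subsequence of length \<open>N\<close>.  If all its multiplicities are below \<open>N - 1\<close>, it is already as
  desired.  Otherwise some \<open>g\<close> occurs at least \<open>N - 1\<close> times.  Split off \<open>N - 1\<close> copies of \<open>g\<close>,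
  leaving \<open>T\<close>, and translate \<open>T\<close> by \<open>-g\<close>.  A zero-sum subsequence of the translate of length between
  \<open>1\<close> and \<open>N\<close> could be filled up with copies of \<open>g\<close> to a zero-sum subsequence of \<open>S\<close> of length
  exactly \<open>N\<close>; so there is none.  Every sequence of length \<open>2m + mn - 2\<close> over \<open>G\<close> does have such a
  short zero-sum subsequence (\<open>short_zero_sum_rank_two\<close>), whence
  \<open>|S| \<le> (N - 1) + (2m + mn - 3) = 2m + 2mn - 4\<close> (\<open>size_le_if_high_multiplicity\<close>).  On the other
  hand, with \<open>e1, e2\<close> the generators of the two factors, the sequence
  \<open>0^(2m-1) e1^((n-1)m-1) e2^(2m-1) (e1+e2)^((n-1)m-1)\<close> has length \<open>2m + 2mn - 4\<close>, no zero-sum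
  subsequence of length \<open>N\<close>, and multiplicities below \<open>N - 1\<close>, because \<open>m \<ge> 2\<close> and \<open>n \<ge> 3\<close>
  (\<open>long_sequence_low_multiplicity\<close>); any of its subsequences of length \<open>|S|\<close> is the sequence sought.

  The bound on short zero-sum subsequences goes by induction on \<open>m\<close>.  If a prime \<open>p\<close> divides
  \<open>m\<close>, a sequence of length \<open>2m + mn - 2\<close> contains enough disjoint blocks of length at most \<open>p\<close> whose
  sums lie in \<open>pG\<close> to apply the bound for \<open>m/p\<close> to the sequence of these sums.  The
  blocks come from the same bound for \<open>C\<^sub>p \<oplus> C\<^sub>p\<close>, which follows from Olson's theorem on zero-sum
  subsequences over \<open>C\<^sub>p \<oplus> \<dots> \<oplus> C\<^sub>p\<close> in ranks two and three (\<open>olson_elementary\<close>); that theorem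
  is proved by the polynomial method.
\<close>

section \<open>Polynomial functions of a finite set\<close>

text \<open>
  Functions of a set \<open>I\<close> that are polynomials of degree at most \<open>d\<close> in the indicators of \<open>i \<in> I\<close>.
  The inductive form lets facts about them be proved one linear factor at a time; the index \<open>d\<close>
  is an upper bound, not the exact degree.
\<close>

inductive subset_poly :: "nat \<Rightarrow> ('i set \<Rightarrow> int) \<Rightarrow> bool" where
  const: "subset_poly d (\<lambda>_. c)"
| add: "subset_poly d f \<Longrightarrow> subset_poly d g \<Longrightarrow> subset_poly d (\<lambda>I. f I + g I)"
| mult_linear: "subset_poly d f \<Longrightarrow> subset_poly (Suc d) (\<lambda>I. (\<Sum>i\<in>I. a i) * f I)"

lemma subset_poly_mono:
  assumes "subset_poly d f" "d \<le> e"
  shows "subset_poly e f"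
  using assms
proof (induction arbitrary: e rule: subset_poly.induct)
  case (mult_linear d f a)
  then obtain e' where "e = Suc e'" "d \<le> e'" by (cases e) auto
  with mult_linear show ?case by (auto intro: subset_poly.mult_linear)
qed (auto intro: subset_poly.intros)

lemma subset_poly_scale: "subset_poly d f \<Longrightarrow> subset_poly d (\<lambda>I. c * f I)"
proof (induction rule: subset_poly.induct)
  case (const d c')
  show ?case by (rule subset_poly.const)
next
  case (add d f g)
  then show ?case using subset_poly.add[OF add.IH] by (simp add: distrib_left)
next
  case (mult_linear d f a)
  then show ?case using subset_poly.mult_linear[OF mult_linear.IH, of a]
    by (simp add: mult.left_commute)
qed

lemma subset_poly_mult:
  assumes "subset_poly d f" "subset_poly e g"
  shows "subset_poly (d + e) (\<lambda>I. f I * g I)"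
  using assms
proof (induction rule: subset_poly.induct)
  case (const d c)
  then show ?case by (intro subset_poly_scale) (auto intro: subset_poly_mono)
next
  case (add d f f')
  then show ?case using subset_poly.add[of "d + e" "\<lambda>I. f I * g I" "\<lambda>I. f' I * g I"]
    by (simp add: distrib_right)
next
  case (mult_linear d f a)
  then show ?case using subset_poly.mult_linear[of "d + e" "\<lambda>I. f I * g I" a]
    by (simp add: mult.assoc)
qed

lemma subset_poly_linear: "subset_poly 1 (\<lambda>I. \<Sum>i\<in>I. a i)"
  using subset_poly.mult_linear[OF subset_poly.const[of 0 1], of a] by simp

lemma subset_poly_power:
  assumes "subset_poly d f"
  shows "subset_poly (k * d) (\<lambda>I. f I ^ k)"
proof (induction k)
  case 0
  show ?case using subset_poly.const[of 0 1] by simp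
next
  case (Suc k)
  then show ?case using subset_poly_mult[OF assms Suc] by simp
qed

lemma subset_poly_prod:
  assumes "finite R" "\<And>r. r \<in> R \<Longrightarrow> subset_poly d (f r)"
  shows "subset_poly (card R * d) (\<lambda>I. \<Prod>r\<in>R. f r I)"
  using assms
proof (induction R rule: finite_induct)
  case empty
  show ?case using subset_poly.const[of 0 1] by simp
next
  case (insert r R)
  then have "subset_poly d (f r)" "subset_poly (card R * d) (\<lambda>I. \<Prod>r\<in>R. f r I)"
    by auto
  then have "subset_poly (d + card R * d) (\<lambda>I. f r I * (\<Prod>r\<in>R. f r I))"
    by (rule subset_poly_mult)
  with insert show ?case by simp
qed

text \<open>
  Adding or removing a fixed \<open>x \<in> L - J\<close> pairs off the sets of the interval with opposite signs.
\<close>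

lemma sum_sign_interval_eq_0:
  assumes "finite L" "J \<subset> L"
  shows "(\<Sum>I | J \<subseteq> I \<and> I \<subseteq> L. (- 1) ^ card I) = (0::int)"
proof -
  obtain x where x: "x \<in> L" "x \<notin> J" using assms by auto
  define t where "t I = (if x \<in> I then I - {x} else insert x I)" for I
  have sgn: "(- 1) ^ card (t I) = - ((- 1) ^ card I :: int)" if "I \<subseteq> L" for I
  proof -
    have fin: "finite I" using that assms finite_subset by blast
    show ?thesis
    proof (cases "x \<in> I")
      case True
      then have "card I = Suc (card (t I))" using card.remove[OF fin] by (simp add: t_def)
      then show ?thesis by simp
    next
      case False
      then show ?thesis using fin unfolding t_def by simp
    qed
  qed
  have "(\<Sum>I | J \<subseteq> I \<and> I \<subseteq> L. (- 1) ^ card I) = (\<Sum>I | J \<subseteq> I \<and> I \<subseteq> L. - ((- 1) ^ card I :: int))"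
    by (rule sum.reindex_bij_witness[where i = t and j = t])
      (use x sgn in \<open>auto simp: t_def split: if_splits\<close>)
  then show ?thesis by (simp add: sum_negf)
qed

text \<open>
  This is the polynomial identity behind Olson's theorem: an alternating sum over a cube kills every
  polynomial whose degree is below the dimension.  The lower end \<open>J\<close> has to vary, because
  a linear factor \<open>\<Sum>i\<in>I. a i\<close> splits the sum over \<open>I \<supseteq> J\<close> into sums over \<open>I \<supseteq> J \<union> {i}\<close>:
  each factor costs one degree and at most one dimension.
\<close>

lemma subset_poly_sum_sign_eq_0:
  assumes "subset_poly d f" "finite L" "J \<subseteq> L" "d < card (L - J)"
  shows "(\<Sum>I | J \<subseteq> I \<and> I \<subseteq> L. (- 1) ^ card I * f I) = 0"
  using assms
proof (induction arbitrary: J rule: subset_poly.induct)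
  case (const d c)
  then have "J \<subset> L" by auto
  with const show ?case by (simp add: sum_sign_interval_eq_0 flip: sum_distrib_right)
next
  case (add d f g)
  then show ?case by (simp add: distrib_left sum.distrib)
next
  case (mult_linear d f a)
  have fin: "finite {I. J \<subseteq> I \<and> I \<subseteq> L}" using mult_linear.prems by simp
  \<comment> \<open>If \<open>i\<close> already lies in \<open>J\<close>, the dimension does not drop at all.\<close>
  have zero: "(\<Sum>I | insert i J \<subseteq> I \<and> I \<subseteq> L. (- 1) ^ card I * f I) = 0" if "i \<in> L" for i
  proof (rule mult_linear.IH)
    have "L - insert i J = (L - J) - {i}" by auto
    then show "d < card (L - insert i J)"
      using mult_linear.prems by (cases "i \<in> L - J") auto
  qed (use mult_linear.prems that in auto)
  have "(\<Sum>I | J \<subseteq> I \<and> I \<subseteq> L. (- 1) ^ card I * ((\<Sum>i\<in>I. a i) * f I))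
      = (\<Sum>I | J \<subseteq> I \<and> I \<subseteq> L. \<Sum>i\<in>L. if i \<in> I then a i * ((- 1) ^ card I * f I) else 0)"
  proof (rule sum.cong[OF refl])
    fix I assume "I \<in> {I. J \<subseteq> I \<and> I \<subseteq> L}"
    then have "L \<inter> I = I" by auto
    then show "(- 1) ^ card I * ((\<Sum>i\<in>I. a i) * f I)
        = (\<Sum>i\<in>L. if i \<in> I then a i * ((- 1) ^ card I * f I) else 0)"
      using sum.inter_restrict[OF mult_linear.prems(1), of "\<lambda>i. a i * ((- 1) ^ card I * f I)" I]
      by (simp add: mult.left_commute flip: sum_distrib_right)
  qed
  also have "\<dots> = (\<Sum>i\<in>L. \<Sum>I | J \<subseteq> I \<and> I \<subseteq> L. if i \<in> I then a i * ((- 1) ^ card I * f I) else 0)"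
    by (rule sum.swap)
  also have "\<dots> = (\<Sum>i\<in>L. a i * (\<Sum>I | insert i J \<subseteq> I \<and> I \<subseteq> L. (- 1) ^ card I * f I))"
  proof (rule sum.cong[OF refl])
    fix i
    have eq: "{I. insert i J \<subseteq> I \<and> I \<subseteq> L} = {I \<in> {I. J \<subseteq> I \<and> I \<subseteq> L}. i \<in> I}" by auto
    show "(\<Sum>I | J \<subseteq> I \<and> I \<subseteq> L. if i \<in> I then a i * ((- 1) ^ card I * f I) else 0)
        = a i * (\<Sum>I | insert i J \<subseteq> I \<and> I \<subseteq> L. (- 1) ^ card I * f I)"
      unfolding sum_distrib_left eq by (rule sum.inter_filter[OF fin, symmetric])
  qed
  also have "\<dots> = 0" using zero by simp
  finally show ?case .
qed

section \<open>Short zero-sum subfamilies over groups of rank two\<close>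

lemma fermat_int:
  fixes a :: int
  assumes "Factorial_Ring.prime p" "\<not> int p dvd a"
  shows "int p dvd 1 - a ^ (p - 1)"
proof -
  define b where "b = nat (a mod int p)"
  have p0: "p > 0" using assms prime_gt_0_nat by blast
  then have b: "int b = a mod int p" by (simp add: b_def)
  have "\<not> p dvd b"
    using assms(2) by (simp add: b dvd_mod_iff flip: int_dvd_int_iff)
  then have "[b ^ (p - 1) = 1] (mod p)" by (rule fermat_theorem[OF assms(1)])
  then have "[(a mod int p) ^ (p - 1) = 1] (mod int p)"
    by (simp add: b flip: cong_int_iff)
  then have "[a ^ (p - 1) = 1] (mod int p)"
    by (simp add: cong_def power_mod)
  then show ?thesis by (simp add: cong_iff_dvd_diff dvd_diff_commute)
qed

text \<open>
  The Davenport constant of an elementary abelian \<open>p\<close>-group of rank \<open>|R|\<close> is at most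
  \<open>|R| (p - 1) + 1\<close>.
  By Fermat, \<open>f I = (\<Prod>r\<in>R. 1 - (\<Sum>i\<in>I. v r i) ^ (p - 1))\<close> vanishes modulo \<open>p\<close> unless
  \<open>I\<close> is zero-sum.  If only the empty set were zero-sum, the alternating sum of \<open>f\<close> would be
  \<open>f {} = 1\<close> modulo \<open>p\<close>, although it is \<open>0\<close> since \<open>f\<close> has degree at most \<open>|R| (p - 1)\<close>.
\<close>

lemma olson_elementary:
  fixes v :: "'r \<Rightarrow> 'i \<Rightarrow> int"
  assumes p: "Factorial_Ring.prime p" and fin: "finite R" "finite L" and card: "card R * (p - 1) < card L"
  obtains I where "I \<subseteq> L" "I \<noteq> {}" "\<And>r. r \<in> R \<Longrightarrow> int p dvd (\<Sum>i\<in>I. v r i)"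
proof (rule ccontr)
  assume "\<not> thesis"
  then have no: "\<exists>r\<in>R. \<not> int p dvd (\<Sum>i\<in>I. v r i)" if "I \<subseteq> L" "I \<noteq> {}" for I
    using that \<open>\<And>I. \<lbrakk>I \<subseteq> L; I \<noteq> {}; \<And>r. r \<in> R \<Longrightarrow> int p dvd sum (v r) I\<rbrakk> \<Longrightarrow> thesis\<close> by blast
  define f where "f I = (\<Prod>r\<in>R. 1 + (- 1) * (\<Sum>i\<in>I. v r i) ^ (p - 1))" for I
  have "subset_poly ((p - 1) * 1) (\<lambda>I. 1 + (- 1) * (\<Sum>i\<in>I. v r i) ^ (p - 1))" for r
    by (intro subset_poly.add subset_poly.const subset_poly_scale subset_poly_power subset_poly_linear)
  then have "subset_poly (card R * (p - 1)) f"
    unfolding f_def by (intro subset_poly_prod[OF fin(1)]) auto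
  then have "(\<Sum>I | {} \<subseteq> I \<and> I \<subseteq> L. (- 1) ^ card I * f I) = 0"
    by (rule subset_poly_sum_sign_eq_0) (use fin card in auto)
  then have "0 = (\<Sum>I\<in>Pow L. (- 1) ^ card I * f I)" by (simp add: Pow_def)
  also have "\<dots> = f {} + (\<Sum>I\<in>Pow L - {{}}. (- 1) ^ card I * f I)"
    using fin by (subst sum.remove[of _ "{}"]) auto
  also have "f {} = 1"
    using prime_gt_1_nat[OF p] by (simp add: f_def zero_power)
  finally have "1 = - (\<Sum>I\<in>Pow L - {{}}. (- 1) ^ card I * f I)" by simp
  moreover have "int p dvd (\<Sum>I\<in>Pow L - {{}}. (- 1) ^ card I * f I)"
  proof (intro dvd_sum dvd_mult)
    fix I assume "I \<in> Pow L - {{}}"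
    then obtain r where r: "r \<in> R" "\<not> int p dvd (\<Sum>i\<in>I. v r i)" using no by auto
    have "int p dvd 1 + (- 1) * (\<Sum>i\<in>I. v r i) ^ (p - 1)"
      using fermat_int[OF p r(2)] by simp
    also have "\<dots> dvd f I" unfolding f_def by (rule dvd_prodI[OF fin(1) r(1)])
    finally show "int p dvd f I" .
  qed
  ultimately have "int p dvd 1" by simp
  then show False using prime_gt_1_nat[OF p] by simp
qed

text \<open>
  Adjoining a third coordinate that is constantly \<open>1\<close> makes Olson's theorem in rank three produce a
  zero-sum set \<open>I\<close> whose size is a multiple of \<open>p\<close>, namely \<open>p\<close> or \<open>2p\<close>.  In the latter case
  the rank-two theorem splits \<open>I\<close> into two nonempty zero-sum parts, and one of them has size at
  most \<open>p\<close>.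
\<close>

lemma short_zero_sum_prime:
  fixes x y :: "'i \<Rightarrow> int"
  assumes p: "Factorial_Ring.prime p" and fin: "finite L" and card: "3 * p \<le> card L + 2"
  obtains I where "I \<subseteq> L" "I \<noteq> {}" "card I \<le> p"
    "int p dvd (\<Sum>i\<in>I. x i)" "int p dvd (\<Sum>i\<in>I. y i)"
proof -
  have p2: "p \<ge> 2" using p prime_ge_2_nat by blast
  have "3 * p - 2 \<le> card L" using card by simp
  then obtain L' where L': "L' \<subseteq> L" "card L' = 3 * p - 2" "finite L'"
    by (rule obtain_subset_with_card_n)
  \<comment> \<open>The third coordinate counts the elements of the chosen set.\<close>
  define v where "v r = (if r = 0 then x else if r = 1 then y else (\<lambda>_. 1))" for r :: nat
  have "3 * (p - 1) < card L'" using L'(2) p2 by linarith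
  then have "card {0, 1, 2 :: nat} * (p - 1) < card L'" by (simp add: numeral_3_eq_3)
  then obtain I where I: "I \<subseteq> L'" "I \<noteq> {}" "\<And>r. r \<in> {0, 1, 2} \<Longrightarrow> int p dvd (\<Sum>i\<in>I. v r i)"
    using olson_elementary[OF p _ L'(3), of "{0, 1, 2}" v] by blast
  have Ix: "int p dvd (\<Sum>i\<in>I. x i)" and Iy: "int p dvd (\<Sum>i\<in>I. y i)" and "int p dvd int (card I)"
    using I(3)[of 0] I(3)[of 1] I(3)[of 2] by (simp_all add: v_def)
  then obtain q where q: "card I = p * q" by auto
  have finI: "finite I" using I L' finite_subset by blast
  have "card I \<le> 3 * p - 2" using I(1) L' card_mono by metis
  then have "p * q < p * 3" using q p2 by linarith
  then have "q \<le> 2" by simp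
  show ?thesis
  proof (cases "q \<le> 1")
    case True
    then have "card I \<le> p" using q by simp
    with I(1,2) L'(1) Ix Iy show ?thesis by (intro that[of I]) auto
  next
    case False
    then have "q = 2" using \<open>q \<le> 2\<close> by linarith
    with q have cI: "card I = 2 * p" by simp
    obtain i where i: "i \<in> I" using I by auto
    have "card {0, 1 :: nat} * (p - 1) < card (I - {i})" using i cI p2 by simp
    then obtain J where J: "J \<subseteq> I - {i}" "J \<noteq> {}" "\<And>r. r \<in> {0, 1} \<Longrightarrow> int p dvd (\<Sum>i\<in>J. v r i)"
      using olson_elementary[OF p _ finite_Diff[OF finI], of "{0, 1}" "{i}" v] by blast
    have Jx: "int p dvd (\<Sum>i\<in>J. x i)" and Jy: "int p dvd (\<Sum>i\<in>J. y i)"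
      using J(3)[of 0] J(3)[of 1] by (simp_all add: v_def)
    have JI: "J \<subseteq> I" using J(1) by blast
    show ?thesis
    proof (cases "card J \<le> p")
      case True
      show ?thesis using JI I(1) L'(1) J(2) True Jx Jy by (intro that[of J]) blast+
    next
      case False
      have "card (I - J) \<le> p"
        using False cI JI finI by (simp add: card_Diff_subset finite_subset)
      moreover have "int p dvd (\<Sum>i\<in>I - J. x i)" "int p dvd (\<Sum>i\<in>I - J. y i)"
        using Ix Iy Jx Jy by (simp_all add: sum_diff[OF finI JI])
      moreover have "I - J \<subseteq> L" "I - J \<noteq> {}" using i J(1) I(1) L'(1) by blast+
      ultimately show ?thesis by (intro that[of "I - J"])
    qed
  qed
qed

text \<open>
  Extracting sets of size at most \<open>p\<close> one after the other works as long as \<open>3p - 2\<close> indices remain: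
  the first \<open>t - 1\<close> sets use up at most \<open>p (t - 1)\<close> of at least \<open>p t + 2p - 2\<close> indices.
\<close>

lemma disjoint_short_zero_sums_prime:
  fixes x y :: "'i \<Rightarrow> int"
  assumes p: "Factorial_Ring.prime p"
  shows "finite L \<Longrightarrow> 2 * p + p * t \<le> card L + 2 \<Longrightarrow>
    \<exists>F :: nat \<Rightarrow> 'i set. disjoint_family_on F {..<t} \<and>
      (\<forall>j<t. F j \<subseteq> L \<and> F j \<noteq> {} \<and> card (F j) \<le> p \<and>
         int p dvd (\<Sum>i\<in>F j. x i) \<and> int p dvd (\<Sum>i\<in>F j. y i))"
proof (induction t arbitrary: L)
  case 0
  show ?case by (simp add: disjoint_family_on_def)
next
  case (Suc t)
  have "3 * p \<le> card L + 2" using Suc.prems(2) by simp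
  then obtain I where I: "I \<subseteq> L" "I \<noteq> {}" "card I \<le> p"
    "int p dvd (\<Sum>i\<in>I. x i)" "int p dvd (\<Sum>i\<in>I. y i)"
    by (rule short_zero_sum_prime[OF p Suc.prems(1), of x y])
  have finI: "finite I" using I(1) Suc.prems(1) finite_subset by blast
  have "card (L - I) = card L - card I" by (rule card_Diff_subset[OF finI I(1)])
  moreover have "card I \<le> card L" by (rule card_mono[OF Suc.prems(1) I(1)])
  ultimately have c: "2 * p + p * t \<le> card (L - I) + 2" using I(3) Suc.prems(2) by simp
  obtain F where F: "disjoint_family_on F {..<t}"
    "\<And>j. j < t \<Longrightarrow> F j \<subseteq> L - I \<and> F j \<noteq> {} \<and> card (F j) \<le> p \<and>
       int p dvd (\<Sum>i\<in>F j. x i) \<and> int p dvd (\<Sum>i\<in>F j. y i)"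
    using Suc.IH[OF finite_Diff[OF Suc.prems(1)] c] by blast
  define H where "H = F(t := I)"
  have H: "H t = I" "\<And>j. j < t \<Longrightarrow> H j = F j" by (simp_all add: H_def)
  have FI: "F i \<inter> I = {}" if "i < t" for i using F(2)[OF that] by blast
  have "H i \<inter> H j = {}" if ij: "i < Suc t" "j < Suc t" "i \<noteq> j" for i j
  proof -
    consider "i < t" "j < t" | "i = t" "j < t" | "i < t" "j = t" using ij by linarith
    then show ?thesis
    proof cases
      case 1
      then have "F i \<inter> F j = {}" using F(1) ij(3) unfolding disjoint_family_on_def by blast
      with 1 show ?thesis by (simp add: H(2))
    next
      case 2
      then show ?thesis using FI[of j] by (simp add: H Int_commute)
    next
      case 3
      then show ?thesis using FI[of i] by (simp add: H)
    qed
  qed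
  then have "disjoint_family_on H {..<Suc t}"
    unfolding disjoint_family_on_def by simp
  moreover have "H j \<subseteq> L \<and> H j \<noteq> {} \<and> card (H j) \<le> p \<and>
       int p dvd (\<Sum>i\<in>H j. x i) \<and> int p dvd (\<Sum>i\<in>H j. y i)" if "j < Suc t" for j
  proof (cases "j = t")
    case True
    then show ?thesis using I by (simp add: H(1))
  next
    case False
    then have "j < t" using that by simp
    from F(2)[OF this] show ?thesis unfolding H(2)[OF \<open>j < t\<close>] by blast
  qed
  ultimately show ?case by (intro exI[of _ H]) simp
qed

text \<open>
  Two of the \<open>n + 1\<close> initial partial sums agree modulo \<open>n\<close>, so the segment between them is zero-sum.
\<close>

lemma short_zero_sum_cyclic:
  fixes y :: "'i \<Rightarrow> int"
  assumes "n > 0" "finite L" "n \<le> card L"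
  obtains I where "I \<subseteq> L" "I \<noteq> {}" "card I \<le> n" "int n dvd (\<Sum>i\<in>I. y i)"
proof -
  obtain L' where L': "L' \<subseteq> L" "card L' = n" "finite L'"
    using obtain_subset_with_card_n[OF assms(3)] by blast
  obtain h where h: "bij_betw h {..<n} L'"
    using ex_bij_betw_nat_finite[OF L'(3)] L'(2) by (auto simp: atLeast0LessThan)
  define s where "s k = (\<Sum>i<k. y (h i)) mod int n" for k
  have "s ` {..n} \<subseteq> {0..<int n}" using assms by (auto simp: s_def)
  then have "card (s ` {..n}) \<le> n" using card_mono[of "{0..<int n}" "s ` {..n}"] by simp
  then have "\<not> inj_on s {..n}" using pigeonhole[of s "{..n}"] by simp
  then obtain a b where ab: "a < b" "b \<le> n" "s a = s b"
  proof -
    obtain a b where "a \<le> n" "b \<le> n" "s a = s b" "a \<noteq> b"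
      using \<open>\<not> inj_on s {..n}\<close> unfolding inj_on_def by blast
    then consider "a < b" | "b < a" by linarith
    then show ?thesis by cases (use that \<open>a \<le> n\<close> \<open>b \<le> n\<close> \<open>s a = s b\<close> in auto)
  qed
  define I where "I = h ` {a..<b}"
  have inj: "inj_on h {a..<b}"
    using ab by (intro inj_on_subset[OF bij_betw_imp_inj_on[OF h]]) auto
  have "(\<Sum>i<b. y (h i)) = (\<Sum>i<a. y (h i)) + (\<Sum>i\<in>{a..<b}. y (h i))"
    using sum.atLeastLessThan_concat[of 0 a b "\<lambda>i. y (h i)"] ab by (simp add: atLeast0LessThan)
  moreover have "int n dvd (\<Sum>i<b. y (h i)) - (\<Sum>i<a. y (h i))"
    using ab(3) unfolding s_def by (metis mod_eq_dvd_iff)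
  ultimately have "int n dvd (\<Sum>i\<in>{a..<b}. y (h i))" by simp
  then have dvd: "int n dvd (\<Sum>i\<in>I. y i)" unfolding I_def by (simp add: sum.reindex[OF inj])
  have "I \<subseteq> L'" unfolding I_def bij_betw_imp_surj_on[OF h, symmetric] using ab by (intro image_mono) auto
  then have IL: "I \<subseteq> L" using L'(1) by blast
  have "card I \<le> n" using ab card_image[OF inj] by (simp add: I_def)
  moreover have "I \<noteq> {}" using ab by (simp add: I_def)
  ultimately show ?thesis using IL dvd by (intro that[of I])
qed

text \<open>
  In the literature, this bounds the constant \<open>\<eta>(C\<^sub>m \<oplus> C\<^bsub>mn\<^esub>)\<close>.  The length \<open>2m + mn - 2\<close>
  is exactly compatible with the step from \<open>k = m/p\<close> to \<open>m\<close>: with \<open>t = 2k + kn - 2\<close>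
  it equals \<open>pt + 2p - 2\<close>, which is what the extraction of \<open>t\<close> blocks requires.
\<close>

lemma short_zero_sum_rank_two:
  fixes x y :: "nat \<Rightarrow> int"
  assumes "m > 0" "n > 0" "finite L" "2 * m + m * n \<le> card L + 2"
  shows "\<exists>I\<subseteq>L. I \<noteq> {} \<and> card I \<le> m * n \<and>
    int m dvd (\<Sum>i\<in>I. x i) \<and> int (m * n) dvd (\<Sum>i\<in>I. y i)"
  using assms
proof (induction m arbitrary: x y L rule: less_induct)
  case (less m)
  show ?case
  proof (cases "m = 1")
    case True
    then have "n \<le> card L" using less.prems by simp
    then show ?thesis using short_zero_sum_cyclic[OF less.prems(2,3), of y] True
      by (metis mult_1 of_nat_1 one_dvd)
  next
    case False
    then obtain p where p: "Factorial_Ring.prime p" "p dvd m" using prime_factor_nat by blast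
    then obtain k where k: "m = p * k" by blast
    have p2: "p \<ge> 2" using p prime_ge_2_nat by blast
    have k0: "k > 0" "k < m" using k less.prems(1) p2 by auto
    \<comment> \<open>The number of blocks for which the induction hypothesis applies to \<open>k\<close>.\<close>
    define t where "t = 2 * k + k * n - 2"
    have t: "2 * k + k * n = t + 2" using k0 less.prems(2) by (simp add: t_def)
    have "2 * m + m * n = p * (2 * k + k * n)" by (simp add: k algebra_simps)
    then have "2 * m + m * n = p * (t + 2)" by (simp only: t)
    then have "2 * p + p * t \<le> card L + 2" using less.prems(4) by (simp add: algebra_simps)
    then obtain F where F: "disjoint_family_on F {..<t}"
      "\<And>j. j < t \<Longrightarrow> F j \<subseteq> L \<and> F j \<noteq> {} \<and> card (F j) \<le> p \<and>
         int p dvd (\<Sum>i\<in>F j. x i) \<and> int p dvd (\<Sum>i\<in>F j. y i)"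
      using disjoint_short_zero_sums_prime[OF p(1) less.prems(3)] by metis
    define x' y' where "x' j = (\<Sum>i\<in>F j. x i) div int p" "y' j = (\<Sum>i\<in>F j. y i) div int p" for j
    obtain J where J: "J \<subseteq> {..<t}" "J \<noteq> {}" "card J \<le> k * n"
      "int k dvd (\<Sum>j\<in>J. x' j)" "int (k * n) dvd (\<Sum>j\<in>J. y' j)"
      using less.IH[OF k0(2,1) less.prems(2), of "{..<t}" x' y'] t by auto
    define I where "I = (\<Union>j\<in>J. F j)"
    have FJ: "F j \<subseteq> L" "finite (F j)" "F j \<noteq> {}" "card (F j) \<le> p"
      "int p dvd (\<Sum>i\<in>F j. x i)" "int p dvd (\<Sum>i\<in>F j. y i)" if "j \<in> J" for j
    proof -
      have "j < t" using J(1) that by auto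
      from F(2)[OF this] show "F j \<subseteq> L" "F j \<noteq> {}" "card (F j) \<le> p"
        "int p dvd (\<Sum>i\<in>F j. x i)" "int p dvd (\<Sum>i\<in>F j. y i)" by blast+
      then show "finite (F j)" using less.prems(3) finite_subset by blast
    qed
    have finJ: "finite J" using J(1) finite_subset by blast
    have union: "(\<Sum>i\<in>I. w i) = (\<Sum>j\<in>J. \<Sum>i\<in>F j. w i)" for w :: "nat \<Rightarrow> int"
      unfolding I_def using F(1) J(1) FJ(2) finJ
      by (intro sum.UNION_disjoint) (auto simp: disjoint_family_on_def)
    have "(\<Sum>i\<in>I. x i) = int p * (\<Sum>j\<in>J. x' j)"
      unfolding union sum_distrib_left x'_y'_def by (rule sum.cong[OF refl]) (simp add: FJ(5))
    then have dx: "int m dvd (\<Sum>i\<in>I. x i)" using J(4) by (simp add: k)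
    have "(\<Sum>i\<in>I. y i) = int p * (\<Sum>j\<in>J. y' j)"
      unfolding union sum_distrib_left x'_y'_def by (rule sum.cong[OF refl]) (simp add: FJ(6))
    then have dy: "int (m * n) dvd (\<Sum>i\<in>I. y i)" using J(5) by (simp add: k mult.assoc)
    have "card I \<le> (\<Sum>j\<in>J. card (F j))" unfolding I_def using finJ by (rule card_UN_le)
    also have "\<dots> \<le> card J * p" using sum_bounded_above[of J "\<lambda>j. card (F j)" p] FJ(4) by simp
    also have "\<dots> \<le> k * n * p" using J(3) by simp
    finally have "card I \<le> m * n" by (simp add: k mult.commute mult.left_commute)
    moreover have "I \<subseteq> L" unfolding I_def using FJ(1) by blast
    moreover have "I \<noteq> {}" unfolding I_def using FJ(3) J(2) by blast
    ultimately show ?thesis using dx dy by blast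
  qed
qed

lemma short_zero_sum_submultiset:
  fixes u v :: "'g \<Rightarrow> int"
  assumes "m > 0" "n > 0" "2 * m + m * n \<le> size T + 2"
  obtains U where "U \<subseteq># T" "U \<noteq> {#}" "size U \<le> m * n"
    "int m dvd (\<Sum>g\<in>#U. u g)" "int (m * n) dvd (\<Sum>g\<in>#U. v g)"
proof -
  obtain xs where xs: "mset xs = T" using ex_mset by blast
  have T: "T = image_mset ((!) xs) (mset_set {..<length xs})"
    by (metis xs atLeast0LessThan map_nth mset_map mset_upt)
  have "2 * m + m * n \<le> card {..<length xs} + 2" using assms(3) by (simp add: xs[symmetric])
  then obtain I where I: "I \<subseteq> {..<length xs}" "I \<noteq> {}" "card I \<le> m * n"
    "int m dvd (\<Sum>i\<in>I. u (xs ! i))" "int (m * n) dvd (\<Sum>i\<in>I. v (xs ! i))"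
    using short_zero_sum_rank_two[OF assms(1,2) finite_lessThan,
        of "length xs" "\<lambda>i. u (xs ! i)" "\<lambda>i. v (xs ! i)"] by blast
  have fin: "finite I" using I(1) finite_subset by blast
  show ?thesis
  proof (rule that[of "image_mset ((!) xs) (mset_set I)"])
    show "image_mset ((!) xs) (mset_set I) \<subseteq># T"
      unfolding T using I(1) by (intro image_mset_subseteq_mono) (simp add: subset_imp_msubset_mset_set)
  qed (use I fin in \<open>auto simp: image_mset.compositionality comp_def mset_set_empty_iff simp flip: sum_unfold_sum_mset\<close>)
qed

section \<open>Zero-sum sequences in coordinates\<close>

lemma sum_mset_conv_sum_superset:
  fixes f :: "'a \<Rightarrow> int"
  assumes "finite K" "set_mset S \<subseteq> K"
  shows "(\<Sum>g\<in>#S. f g) = (\<Sum>g\<in>K. int (count S g) * f g)"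
  using assms(2)
proof (induction S)
  case (add x S)
  have "(\<Sum>g\<in>K. int (count (add_mset x S) g) * f g)
      = (\<Sum>g\<in>K. int (count S g) * f g + (if g = x then f g else 0))"
    by (intro sum.cong) (auto simp: distrib_right)
  with add assms(1) show ?case by (simp add: sum.distrib)
qed simp

lemma cyclic_group_coordinate:
  fixes A :: "'a monoid"
  assumes "group A" "cyclic_group A" "order A = m" "m > 0"
  obtains a u where "a \<in> carrier A"
    "\<And>g. g \<in> carrier A \<Longrightarrow> a [^]\<^bsub>A\<^esub> (u g :: int) = g"
    "\<And>k :: int. a [^]\<^bsub>A\<^esub> k = \<one>\<^bsub>A\<^esub> \<longleftrightarrow> int m dvd k"
    "\<And>k :: int. 0 \<le> k \<Longrightarrow> k < int m \<Longrightarrow> u (a [^]\<^bsub>A\<^esub> k) = k"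
proof -
  interpret A: group A by fact
  obtain a where a: "a \<in> carrier A" "carrier A = range (\<lambda>n::int. a [^]\<^bsub>A\<^esub> n)"
    using assms(2) A.cyclic_group by auto
  have "generate A {a} = carrier A" using A.generate_pow[OF a(1)] a(2) by auto
  then have ord: "A.ord a = m" using A.generate_pow_card[OF a(1)] assms(3) by (simp add: order_def)
  have eq: "a [^]\<^bsub>A\<^esub> (i::int) = a [^]\<^bsub>A\<^esub> (j::int) \<longleftrightarrow> i mod int m = j mod int m" for i j
    using A.int_pow_eq[OF a(1)] ord by (metis mod_eq_dvd_iff)
  define w where "w g = (SOME k::int. a [^]\<^bsub>A\<^esub> k = g)" for g
  have w: "a [^]\<^bsub>A\<^esub> w g = g" if "g \<in> carrier A" for g
    using that a(2) unfolding w_def by (metis (mono_tags, lifting) imageE someI_ex)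
  show ?thesis
  proof (rule that[of a "\<lambda>g. w g mod int m"])
    show "a [^]\<^bsub>A\<^esub> (w g mod int m) = g" if "g \<in> carrier A" for g
      using w[OF that] eq[of "w g mod int m" "w g"] by simp
    show "a [^]\<^bsub>A\<^esub> k = \<one>\<^bsub>A\<^esub> \<longleftrightarrow> int m dvd k" for k :: int
      using A.int_pow_eq_id[OF a(1)] ord by simp
    show "w (a [^]\<^bsub>A\<^esub> k) mod int m = k" if "0 \<le> k" "k < int m" for k
      using w[of "a [^]\<^bsub>A\<^esub> k"] eq a(1) that by simp
  qed (use a in auto)
qed

lemma nat_pow_DirProd: "(a, b) [^]\<^bsub>A \<times>\<times> B\<^esub> (k::nat) = (a [^]\<^bsub>A\<^esub> k, b [^]\<^bsub>B\<^esub> k)"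
  by (induction k) simp_all

lemma comm_group_DirProd:
  assumes "comm_group A" "comm_group B"
  shows "comm_group (A \<times>\<times> B)"
proof -
  interpret A: comm_group A by fact
  interpret B: comm_group B by fact
  interpret P: group "A \<times>\<times> B" by (intro DirProd_group A.is_group B.is_group)
  show ?thesis by (rule P.group_comm_groupI) (auto simp: A.m_comm B.m_comm)
qed

text \<open>
  Discrete logarithms with respect to generators of the two factors turn being zero-sum into two
  divisibilities of integers.  This is the only access to the group structure that the later
  arguments need.
\<close>

lemma zero_sum_coordinates:
  fixes A :: "'a monoid" and B :: "'b monoid"
  assumes "group A" "cyclic_group A" "order A = m" "m > 0"
    and "group B" "cyclic_group B" "order B = n" "n > 0"
  obtains u v :: "'a \<times> 'b \<Rightarrow> int" where
    "\<And>S. set_mset S \<subseteq> carrier (A \<times>\<times> B) \<Longrightarrow>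
       zero_sum (A \<times>\<times> B) S \<longleftrightarrow> int m dvd (\<Sum>g\<in>#S. u g) \<and> int n dvd (\<Sum>g\<in>#S. v g)"
    "\<And>i j. 0 \<le> i \<Longrightarrow> i < int m \<Longrightarrow> 0 \<le> j \<Longrightarrow> j < int n \<Longrightarrow>
       \<exists>g\<in>carrier (A \<times>\<times> B). u g = i \<and> v g = j"
proof -
  interpret A: group A by fact
  interpret B: group B by fact
  interpret G: comm_group "A \<times>\<times> B"
    using A.cyclic_imp_abelian_group B.cyclic_imp_abelian_group assms(2,6)
    by (intro comm_group_DirProd)
  obtain a s where a: "a \<in> carrier A"
    "\<And>g. g \<in> carrier A \<Longrightarrow> a [^]\<^bsub>A\<^esub> (s g :: int) = g"
    "\<And>k :: int. a [^]\<^bsub>A\<^esub> k = \<one>\<^bsub>A\<^esub> \<longleftrightarrow> int m dvd k"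
    "\<And>k :: int. 0 \<le> k \<Longrightarrow> k < int m \<Longrightarrow> s (a [^]\<^bsub>A\<^esub> k) = k"
    using cyclic_group_coordinate[OF assms(1-4)] by blast
  obtain b t where b: "b \<in> carrier B"
    "\<And>g. g \<in> carrier B \<Longrightarrow> b [^]\<^bsub>B\<^esub> (t g :: int) = g"
    "\<And>k :: int. b [^]\<^bsub>B\<^esub> k = \<one>\<^bsub>B\<^esub> \<longleftrightarrow> int n dvd k"
    "\<And>k :: int. 0 \<le> k \<Longrightarrow> k < int n \<Longrightarrow> t (b [^]\<^bsub>B\<^esub> k) = k"
    using cyclic_group_coordinate[OF assms(5-8)] by blast
  have pow: "g [^]\<^bsub>A \<times>\<times> B\<^esub> c = (a [^]\<^bsub>A\<^esub> (int c * s (fst g)), b [^]\<^bsub>B\<^esub> (int c * t (snd g)))"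
    if "g \<in> carrier (A \<times>\<times> B)" for g and c :: nat
  proof -
    have "fst g [^]\<^bsub>A\<^esub> c = a [^]\<^bsub>A\<^esub> (int c * s (fst g))"
      using that A.int_pow_pow[OF a(1), of "s (fst g)" "int c"] a(2)[of "fst g"]
      by (auto simp: int_pow_int mult.commute)
    moreover have "snd g [^]\<^bsub>B\<^esub> c = b [^]\<^bsub>B\<^esub> (int c * t (snd g))"
      using that B.int_pow_pow[OF b(1), of "t (snd g)" "int c"] b(2)[of "snd g"]
      by (auto simp: int_pow_int mult.commute)
    ultimately show ?thesis using nat_pow_DirProd[where a = "fst g" and b = "snd g" and A = A and B = B and k = c] by simp
  qed
  have prod: "(\<Otimes>\<^bsub>A \<times>\<times> B\<^esub>g\<in>K. g [^]\<^bsub>A \<times>\<times> B\<^esub> c g)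
      = (a [^]\<^bsub>A\<^esub> (\<Sum>g\<in>K. int (c g) * s (fst g)), b [^]\<^bsub>B\<^esub> (\<Sum>g\<in>K. int (c g) * t (snd g)))"
    if "finite K" "K \<subseteq> carrier (A \<times>\<times> B)" for K and c :: "_ \<Rightarrow> nat"
    using that
  proof (induction K rule: finite_induct)
    case empty
    show ?case by simp
  next
    case (insert g K)
    then have "(\<Otimes>\<^bsub>A \<times>\<times> B\<^esub>g\<in>insert g K. g [^]\<^bsub>A \<times>\<times> B\<^esub> c g)
        = g [^]\<^bsub>A \<times>\<times> B\<^esub> c g \<otimes>\<^bsub>A \<times>\<times> B\<^esub> (\<Otimes>\<^bsub>A \<times>\<times> B\<^esub>g\<in>K. g [^]\<^bsub>A \<times>\<times> B\<^esub> c g)"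
      by (intro G.finprod_insert) (auto intro!: G.nat_pow_closed simp del: carrier_DirProd)
    with insert show ?case
      using a(1) b(1) pow[of g "c g"] by (simp add: A.int_pow_mult B.int_pow_mult)
  qed
  show ?thesis
  proof (rule that[of "\<lambda>g. s (fst g)" "\<lambda>g. t (snd g)"])
    fix S assume S: "set_mset S \<subseteq> carrier (A \<times>\<times> B)"
    have "(\<Sum>g\<in>#S. s (fst g)) = (\<Sum>g\<in>set_mset S. int (count S g) * s (fst g))"
      "(\<Sum>g\<in>#S. t (snd g)) = (\<Sum>g\<in>set_mset S. int (count S g) * t (snd g))"
      by (simp_all add: sum_mset_conv_sum_superset[OF finite_set_mset subset_refl])
    then show "zero_sum (A \<times>\<times> B) S \<longleftrightarrow>
        int m dvd (\<Sum>g\<in>#S. s (fst g)) \<and> int n dvd (\<Sum>g\<in>#S. t (snd g))"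
      using prod[OF finite_set_mset S] a(3) b(3) by (simp add: zero_sum_def seq_sum_def)
  next
    fix i j :: int assume "0 \<le> i" "i < int m" "0 \<le> j" "j < int n"
    then show "\<exists>g\<in>carrier (A \<times>\<times> B). s (fst g) = i \<and> t (snd g) = j"
      using a(1,4) b(1,4) by (intro bexI[of _ "(a [^]\<^bsub>A\<^esub> i, b [^]\<^bsub>B\<^esub> j)"]) auto
  qed
qed

section \<open>Extremal sequences\<close>

lemma group_exponent_eqI:
  assumes "comm_group G" "e > 0"
    and "\<And>g. g \<in> carrier G \<Longrightarrow> zero_sum G (replicate_mset e g)"
    and "g \<in> carrier G" "\<And>k :: nat. zero_sum G (replicate_mset k g) \<Longrightarrow> e dvd k"
  shows "group_exponent G = e"
proof -
  interpret G: comm_group G by fact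
  have pow: "zero_sum G (replicate_mset k h) \<longleftrightarrow> h [^]\<^bsub>G\<^esub> k = \<one>\<^bsub>G\<^esub>" if "h \<in> carrier G" for k h
  proof (cases "k = 0")
    case False
    have "seq_sum G (replicate_mset k h) = h [^]\<^bsub>G\<^esub> k"
      using False that by (simp add: seq_sum_def)
    then show ?thesis by (simp add: zero_sum_def)
  qed (simp add: zero_sum_def seq_sum_def)
  show ?thesis unfolding group_exponent_def
  proof (rule Least_equality)
    show "0 < e \<and> (\<forall>h\<in>carrier G. h [^]\<^bsub>G\<^esub> e = \<one>\<^bsub>G\<^esub>)" using assms(2,3) pow by blast
  next
    fix k :: nat assume "0 < k \<and> (\<forall>h\<in>carrier G. h [^]\<^bsub>G\<^esub> k = \<one>\<^bsub>G\<^esub>)"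
    then show "e \<le> k" using assms(4,5) pow by (meson dvd_imp_le)
  qed
qed

text \<open>
  The constant is defined as a minimum, so a bound \<open>l\<close> is needed to know that the minimum is attained.
  If it equals \<open>1\<close>, the extremal sequence is empty.
\<close>

lemma s_const_extremal_sequence:
  assumes exp: "group_exponent G > 0"
    and bound: "\<And>S. set_mset S \<subseteq> carrier G \<Longrightarrow> l \<le> size S \<Longrightarrow>
      has_zero_sum_subseq_of_length G (group_exponent G) S"
  obtains S where "set_mset S \<subseteq> carrier G" "size S = s_const G - 1"
    "\<not> has_zero_sum_subseq_of_length G (group_exponent G) S"
proof -
  define P where "P l \<longleftrightarrow> 0 < l \<and> (\<forall>S. set_mset S \<subseteq> carrier G \<and> l \<le> size S
        \<longrightarrow> has_zero_sum_subseq_of_length G (group_exponent G) S)" for l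
  have s: "s_const G = Least P" by (simp add: s_const_def P_def[abs_def])
  have "P (Suc l)" using bound by (simp add: P_def)
  then have Ps: "P (s_const G)" unfolding s by (rule LeastI)
  show ?thesis
  proof (cases "s_const G = 1")
    case True
    have "\<not> has_zero_sum_subseq_of_length G (group_exponent G) {#}"
      using exp by (auto simp: has_zero_sum_subseq_of_length_def)
    with True show ?thesis by (intro that[of "{#}"]) auto
  next
    case False
    have "s_const G > 0" using Ps by (simp add: P_def)
    then have "s_const G - 1 < Least P" by (simp add: s)
    then have "\<not> P (s_const G - 1)" by (rule not_less_Least)
    moreover have "0 < s_const G - 1" using False \<open>s_const G > 0\<close> by simp
    ultimately obtain S where S: "set_mset S \<subseteq> carrier G" "s_const G - 1 \<le> size S"
      "\<not> has_zero_sum_subseq_of_length G (group_exponent G) S" unfolding P_def by blast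
    have "\<not> s_const G \<le> size S" using Ps S unfolding P_def by blast
    with S show ?thesis by (intro that[of S]) auto
  qed
qed

lemma has_zero_sum_subseq_mono:
  "has_zero_sum_subseq_of_length G k S \<Longrightarrow> S \<subseteq># S' \<Longrightarrow> has_zero_sum_subseq_of_length G k S'"
  unfolding has_zero_sum_subseq_of_length_def by (metis subset_mset.order_trans)

lemma obtain_submultiset_of_size:
  assumes "k \<le> size S"
  obtains T where "T \<subseteq># S" "size T = k"
proof -
  obtain xs where "mset xs = S" using ex_mset by blast
  with assms show ?thesis
    by (metis append_take_drop_id length_take min.absorb2 mset_append mset_subset_eq_add_left size_mset that)
qed

lemma pigeonhole_zero_sum:
  assumes "finite (carrier G)"
    and "\<And>g. g \<in> carrier G \<Longrightarrow> zero_sum G (replicate_mset e g)"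
    and "set_mset S \<subseteq> carrier G" "card (carrier G) * e + 1 \<le> size S"
  shows "has_zero_sum_subseq_of_length G e S"
proof -
  have "\<exists>g\<in>carrier G. e \<le> count S g"
  proof (rule ccontr)
    assume "\<not> (\<exists>g\<in>carrier G. e \<le> count S g)"
    then have le: "count S g \<le> e" if "g \<in> carrier G" for g using that by force
    have "size S = (\<Sum>g\<in>set_mset S. count S g)" by (rule size_multiset_overloaded_eq)
    also have "\<dots> \<le> (\<Sum>g\<in>carrier G. count S g)" using assms by (intro sum_mono2) auto
    also have "\<dots> \<le> card (carrier G) * e" using sum_bounded_above[OF le] by simp
    finally show False using assms(4) by simp
  qed
  then obtain g where "g \<in> carrier G" "e \<le> count S g" by blast
  then show ?thesis
    unfolding has_zero_sum_subseq_of_length_def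
    using assms(2) by (intro exI[of _ "replicate_mset e g"]) (simp add: count_le_replicate_mset_subset_eq)
qed

text \<open>
  Over \<open>C\<^sub>m\<close>, the sequence consisting of \<open>0\<close> with multiplicity \<open>2m - 1\<close> and a generator with
  multiplicity \<open>(n - 1)m - 1\<close> has no zero-sum subsequence of length \<open>mn\<close>: both multiplicities \<open>c0, c1\<close>
  in it would be multiples of \<open>m\<close>, hence at most \<open>m\<close> and \<open>(n - 2)m\<close>, and their sum too small.
\<close>

lemma no_zero_sum_two_elements:
  fixes m n c0 c1 :: nat
  assumes "m > 0" "n \<ge> 2"
    and "c0 \<le> 2 * m - 1" "c1 \<le> (n - 1) * m - 1"
    and "c0 + c1 = m * n" "m dvd c1"
  shows False
proof -
  obtain k where k: "c1 = m * k" using assms by blast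
  show False
  proof (cases "n \<ge> k + 2")
    case True
    then obtain q where "n = k + 2 + q" using le_Suc_ex by blast
    then show False using k assms by (simp add: algebra_simps)
  next
    case False
    then have "(n - 1) * m \<le> k * m" by (intro mult_right_mono) auto
    moreover have "(n - 1) * m > 0" using assms by simp
    moreover have "k * m \<le> (n - 1) * m - 1" using assms(4) k by (simp add: mult.commute)
    ultimately show False by linarith
  qed
qed

text \<open>
  A sequence in which \<open>g\<close> occurs \<open>mn - 1\<close> times can have at most \<open>2m + mn - 3\<close> further terms: a
  short subsequence \<open>U\<close> of these that is zero-sum after translation by \<open>-g\<close> becomes, with
  \<open>mn - |U|\<close> copies of \<open>g\<close>, a zero-sum subsequence of length \<open>mn\<close>, since adding \<open>mn\<close> times \<open>g\<close>
  changes nothing.  The copies suffice because \<open>U\<close> is nonempty.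
\<close>

lemma size_le_if_high_multiplicity:
  fixes u v :: "'g \<Rightarrow> int"
  assumes zs: "\<And>S. set_mset S \<subseteq> carrier G \<Longrightarrow>
       zero_sum G S \<longleftrightarrow> int m dvd (\<Sum>h\<in>#S. u h) \<and> int (m * n) dvd (\<Sum>h\<in>#S. v h)"
    and pos: "m > 0" "n > 0"
    and S: "set_mset S \<subseteq> carrier G" "\<not> has_zero_sum_subseq_of_length G (m * n) S"
    and g: "g \<in> carrier G" "m * n - 1 \<le> count S g"
  shows "size S + 4 \<le> 2 * m + 2 * (m * n)"
proof (rule ccontr)
  assume large: "\<not> size S + 4 \<le> 2 * m + 2 * (m * n)"
  define N where "N = m * n"
  have N: "N > 0" using pos by (simp add: N_def)
  define T where "T = S - replicate_mset (N - 1) g"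
  have "replicate_mset (N - 1) g \<subseteq># S"
    using g(2) by (simp add: N_def count_le_replicate_mset_subset_eq)
  then have ST: "S = T + replicate_mset (N - 1) g" by (simp add: T_def)
  then have "size S = size T + (N - 1)" by simp
  then have "2 * m + m * n \<le> size T + 2"
    using large N unfolding N_def by linarith
  then obtain U where U: "U \<subseteq># T" "U \<noteq> {#}" "size U \<le> m * n"
    "int m dvd (\<Sum>h\<in>#U. u h - u g)" "int (m * n) dvd (\<Sum>h\<in>#U. v h - v g)"
    by (rule short_zero_sum_submultiset[OF pos, of T "\<lambda>h. u h - u g" "\<lambda>h. v h - v g"])
  define W where "W = U + replicate_mset (N - size U) g"
  have "size U > 0" using U(2) by (simp add: nonempty_has_size)
  then have "replicate_mset (N - size U) g \<subseteq># replicate_mset (N - 1) g"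
    unfolding count_le_replicate_mset_subset_eq[symmetric] by simp
  then have WS: "W \<subseteq># S" unfolding W_def ST using U(1) by (intro subset_mset.add_mono)
  have size: "size W = N" using U(3) by (simp add: W_def N_def)
  have shift: "(\<Sum>h\<in>#W. w h) = (\<Sum>h\<in>#U. w h - w g) + int N * w g" for w :: "'g \<Rightarrow> int"
  proof -
    have "(\<Sum>h\<in>#V. w h - w g) = (\<Sum>h\<in>#V. w h) - int (size V) * w g" for V
      by (induction V) (simp_all add: algebra_simps)
    moreover have "int (N - size U) = int N - int (size U)"
      using U(3) by (simp add: N_def of_nat_diff)
    moreover have "(\<Sum>h\<in>#W. w h) = (\<Sum>h\<in>#U. w h) + int (N - size U) * w g"
      by (simp add: W_def)
    ultimately show ?thesis by (simp add: left_diff_distrib)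
  qed
  have "int m dvd (\<Sum>h\<in>#W. u h)"
    unfolding shift by (intro dvd_add U(4)) (simp add: N_def)
  moreover have "int (m * n) dvd (\<Sum>h\<in>#W. v h)"
    unfolding shift by (intro dvd_add U(5)) (simp add: N_def)
  moreover have Wc: "set_mset W \<subseteq> carrier G" using set_mset_mono[OF WS] S(1) by (rule subset_trans)
  ultimately have "zero_sum G W" by (simp only: zs[OF Wc] simp_thms)
  then show False using S(2) WS size unfolding has_zero_sum_subseq_of_length_def N_def by blast
qed

text \<open>
  All terms have second coordinate \<open>0\<close> or \<open>1\<close>.  In a zero-sum subsequence of length \<open>mn\<close> the sum of the
  second coordinates lies between \<open>0\<close> and \<open>mn\<close> and is a multiple of \<open>mn\<close>, so all second
  coordinates are equal.  On each of the two levels the first coordinates form the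
  sequence over \<open>C\<^sub>m\<close> excluded by \<open>no_zero_sum_two_elements\<close>.  Choosing the multiplicities \<open>2m - 1\<close> and
  \<open>(n - 1)m - 1\<close>, rather than \<open>mn - 1\<close> and \<open>m - 1\<close>, keeps the length and makes both small.
\<close>

lemma long_sequence_low_multiplicity:
  fixes u v :: "'g \<Rightarrow> int"
  assumes zs: "\<And>S. set_mset S \<subseteq> carrier G \<Longrightarrow>
       zero_sum G S \<longleftrightarrow> int m dvd (\<Sum>h\<in>#S. u h) \<and> int (m * n) dvd (\<Sum>h\<in>#S. v h)"
    and surj: "\<And>i j. 0 \<le> i \<Longrightarrow> i < int m \<Longrightarrow> 0 \<le> j \<Longrightarrow> j < int (m * n) \<Longrightarrow>
       \<exists>g\<in>carrier G. u g = i \<and> v g = j"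
    and m: "m \<ge> 2" and n: "n \<ge> 3"
  obtains S where "set_mset S \<subseteq> carrier G" "size S + 4 = 2 * m + 2 * (m * n)"
    "\<not> has_zero_sum_subseq_of_length G (m * n) S" "\<forall>g. count S g < m * n - 1"
proof -
  have mn: "m * n = (n - 1) * m + m" using n by (simp add: algebra_simps flip: mult_Suc)
  have "2 * m \<le> (n - 1) * m" using n by (intro mult_right_mono) auto
  with mn m have mn2: "2 * m < m * n" "0 < (n - 1) * m" by linarith+
  have one: "(1::int) < int m" "(1::int) < int (m * n)" using mn2 m by linarith+
  obtain a where a: "a \<in> carrier G" "u a = 0" "v a = 0" using surj[of 0 0] one by auto
  obtain b where b: "b \<in> carrier G" "u b = 1" "v b = 0" using surj[of 1 0] one by auto
  obtain c where c: "c \<in> carrier G" "u c = 0" "v c = 1" using surj[of 0 1] one by auto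
  obtain d where d: "d \<in> carrier G" "u d = 1" "v d = 1" using surj[of 1 1] one by auto
  have dist: "a \<noteq> b" "a \<noteq> c" "a \<noteq> d" "b \<noteq> c" "b \<noteq> d" "c \<noteq> d"
    using a b c d by auto
  define p q where "p = 2 * m - 1" and "q = (n - 1) * m - 1"
  define S where "S = replicate_mset p a + replicate_mset q b + replicate_mset p c + replicate_mset q d"
  show ?thesis
  proof (rule that[of S])
    show "set_mset S \<subseteq> carrier G" using a b c d by (auto simp: S_def)
    have "size S = 2 * p + 2 * q" by (simp add: S_def)
    moreover have "p + 1 = 2 * m" "q + 1 + m = m * n" using m mn mn2 by (simp_all add: p_def q_def)
    ultimately show "size S + 4 = 2 * m + 2 * (m * n)" by linarith
    have "p < m * n - 1" "q < m * n - 1" "0 < m * n - 1" using m mn mn2 unfolding p_def q_def by linarith+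
    then show "\<forall>g. count S g < m * n - 1" using dist by (auto simp: S_def)
    show "\<not> has_zero_sum_subseq_of_length G (m * n) S"
    proof
      assume "has_zero_sum_subseq_of_length G (m * n) S"
      then obtain U where U: "U \<subseteq># S" "size U = m * n" "zero_sum G U"
        unfolding has_zero_sum_subseq_of_length_def by blast
      have le: "count U g \<le> count S g" for g using U(1) by (rule mset_subset_eq_count)
      have bounds: "count U a \<le> p" "count U b \<le> q" "count U c \<le> p" "count U d \<le> q"
        using le[of a] le[of b] le[of c] le[of d] dist by (simp_all add: S_def)
      have K: "set_mset U \<subseteq> {a, b, c, d}"
        using set_mset_mono[OF U(1)] by (auto simp: S_def split: if_splits)
      have sum: "(\<Sum>g\<in>#U. w g) = int (count U a) * w a + int (count U b) * w b
          + int (count U c) * w c + int (count U d) * w d" for w :: "'g \<Rightarrow> int"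
        using dist by (subst sum_mset_conv_sum_superset[OF _ K]) auto
      have "int (size U) = int (count U a) + int (count U b) + int (count U c) + int (count U d)"
        using sum[of "\<lambda>_. 1"] by simp
      then have tot: "count U a + count U b + (count U c + count U d) = m * n"
        using U(2) by linarith
      have "set_mset U \<subseteq> carrier G" using K a b c d by auto
      with zs U(3) have "int m dvd (\<Sum>g\<in>#U. u g)" "int (m * n) dvd (\<Sum>g\<in>#U. v g)" by blast+
      then have "int m dvd int (count U b + count U d)" "int (m * n) dvd int (count U c + count U d)"
        by (simp_all add: sum a b c d)
      then have dm: "m dvd count U b + count U d" and dn: "m * n dvd count U c + count U d"
        unfolding int_dvd_int_iff by blast+
      have n2: "n \<ge> 2" "m > 0" using m n by auto
      show False
      proof (cases "count U c + count U d = 0")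
        case True
        then show False
          using no_zero_sum_two_elements[OF n2(2,1), of "count U a" "count U b"] bounds tot dm
          by (simp add: p_def q_def)
      next
        case False
        then have "m * n \<le> count U c + count U d" using dn by (intro dvd_imp_le) auto
        then have "count U a = 0" "count U b = 0" "count U c + count U d = m * n" using tot by linarith+
        then show False
          using no_zero_sum_two_elements[OF n2(2,1), of "count U c" "count U d"] bounds dm
          by (simp add: p_def q_def)
      qed
    qed
  qed
qed

theorem corollary3p3:
  fixes m n :: nat and A :: "'a monoid" and B :: "'b monoid" and G :: "('a \<times> 'b) monoid"
  assumes "m \<ge> 2" and "n \<ge> 3"
    and "group A" and "cyclic_group A" and "order A = m"
    and "group B" and "cyclic_group B" and "order B = m * n"
    and "G = A \<times>\<times> B"
  shows "\<exists>S. set_mset S \<subseteq> carrier G \<and> size S = s_const G - 1 \<and>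
           \<not> has_zero_sum_subseq_of_length G (group_exponent G) S \<and>
           (\<forall>g\<in>carrier G. count S g < group_exponent G - 1)"
proof -
  define N where "N = m * n"
  have pos: "m > 0" "n > 0" "N > 0" using assms(1,2) by (auto simp: N_def)
  have "2 * 3 \<le> N" unfolding N_def using assms(1,2) by (intro mult_mono) auto
  then have one: "(1::int) < int m" "(1::int) < int N" using assms(1) by linarith+
  obtain u v where zs: "\<And>S. set_mset S \<subseteq> carrier G \<Longrightarrow>
       zero_sum G S \<longleftrightarrow> int m dvd (\<Sum>g\<in>#S. u g) \<and> int N dvd (\<Sum>g\<in>#S. v g)"
    and surj: "\<And>i j. 0 \<le> i \<Longrightarrow> i < int m \<Longrightarrow> 0 \<le> j \<Longrightarrow> j < int N \<Longrightarrow>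
       \<exists>g\<in>carrier G. u g = i \<and> v g = j"
  proof (rule zero_sum_coordinates[OF assms(3-5) pos(1) assms(6-8)[folded N_def] pos(3),
        folded assms(9)], goal_cases)
    case (1 u v)
    show ?thesis by (rule that[of u v]; rule 1)
  qed
  have zN: "zero_sum G (replicate_mset N g)" if "g \<in> carrier G" for g
    using that by (subst zs) (auto simp: N_def)
  have exp: "group_exponent G = N"
  proof -
    obtain g where g: "g \<in> carrier G" "u g = 0" "v g = 1" using surj[of 0 1] one by auto
    show ?thesis
    proof (rule group_exponent_eqI[OF _ pos(3) zN g(1)])
      show "comm_group G" unfolding assms(9)
        using assms(3,4,6,7) by (intro comm_group_DirProd group.cyclic_imp_abelian_group)
      show "N dvd k" if "zero_sum G (replicate_mset k g)" for k
        using that g by (subst (asm) zs) (auto split: if_splits)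
    qed
  qed
  have fin: "finite (carrier G)"
  proof -
    have "card (carrier A) > 0" and "card (carrier B) > 0"
      using assms(5,8) pos by (simp_all add: order_def N_def)
    then have "finite (carrier A)" "finite (carrier B)"
      using card_ge_0_finite by blast+
    then show ?thesis by (simp add: assms(9))
  qed
  obtain S where S: "set_mset S \<subseteq> carrier G" "size S = s_const G - 1"
    "\<not> has_zero_sum_subseq_of_length G N S"
    by (rule s_const_extremal_sequence[of G "card (carrier G) * N + 1", unfolded exp,
          OF pos(3) pigeonhole_zero_sum[OF fin zN]])
  show ?thesis
  proof (cases "\<forall>g\<in>carrier G. count S g < N - 1")
    case True
    with S show ?thesis unfolding exp by (intro exI[of _ S]) simp
  next
    case False
    then obtain g where g: "g \<in> carrier G" "N - 1 \<le> count S g" by (auto simp: not_less)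
    have "size S + 4 \<le> 2 * m + 2 * N"
      unfolding N_def
      by (rule size_le_if_high_multiplicity[OF zs[unfolded N_def] pos(1,2) S(1) S(3)[unfolded N_def]
            g[unfolded N_def]])
    moreover obtain W where W: "set_mset W \<subseteq> carrier G" "size W + 4 = 2 * m + 2 * N"
      "\<not> has_zero_sum_subseq_of_length G N W" "\<forall>g. count W g < N - 1"
      unfolding N_def
      by (rule long_sequence_low_multiplicity[OF zs[unfolded N_def] surj[unfolded N_def] assms(1,2)])
    ultimately have "size S \<le> size W" by linarith
    then obtain V where V: "V \<subseteq># W" "size V = size S" by (rule obtain_submultiset_of_size)
    have "set_mset V \<subseteq> carrier G" using set_mset_mono[OF V(1)] W(1) by blast
    moreover have "\<not> has_zero_sum_subseq_of_length G N V"
      using has_zero_sum_subseq_mono[OF _ V(1), of G N] W(3) by blast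
    moreover have "count V g < N - 1" for g
      using mset_subset_eq_count[OF V(1)] W(4)[rule_format] by (rule le_less_trans)
    ultimately show ?thesis using V(2) S(2) unfolding exp by (intro exI[of _ V]) simp
  qed
qed

end
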